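(* Let $n\ge2$, identify $\mathrm{Free}_n(\mathbf{CH})$ with $G_n^+$ (with free generators $x_1,\ldots,x_n$), and let $\sigma$ be a nontrivial endomorphism of $\mathrm{Free}_n(\mathbf{CH})$. Let $f_i=\sigma(x_i)$ for $1\le i\le n$, let $f_\sharp=f_n+(f_1\lor\cdots\lor f_{n-1})=\sigma(\mathbf{1})$ (a strong unit, never zero, with $0\le f_i\le f_\sharp$ for $i\le n-1$), let $S_i(p)=f_i(p)/f_\sharp(p)$, and let $S:[0,1]^{n-1}\to[0,1]^{n-1}$ be $S(p)=(S_1(p),\ldots,S_{n-1}(p))$. Then, under the identification of $\mathrm{MaxSpec}\,\mathrm{Free}_n(\mathbf{CH})$ with $[0,1]^{n-1}$ given by $p\mapsto\{f\in\mathrm{Free}_n(\mathbf{CH}):f(p)=0\}$, the dual map of $\sigma$ is $S$.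
   Context: A cancellative hoop is an algebra $(A,+,\mathbin{\dot{-}},0)$ with $\mathbin{\dot{-}}$ a truncated difference (on positive cones of $\ell$-groups, $a\mathbin{\dot{-}}b=0\lor(a-b)$); $\mathrm{Free}_n(\mathbf{CH})$ is the free cancellative hoop on $n$ generators. $G_n$ is the $\ell$-group of all McNaughton functions $[0,1]^{n-1}\to\mathbb{R}$ (the $\ell$-group enveloping the free MV-algebra on $n-1$ generators, with strong unit $\mathbf{1}$, the constant function $1$); $x_1,\ldots,x_{n-1}$ are the coordinate projections and $x_n=\mathbf{1}-(x_1\lor\cdots\lor x_{n-1})$; $\mathrm{Free}_n(\mathbf{CH})\cong G_n^+$ with free generators $x_1,\ldots,x_n$. An endomorphism $\sigma$ is nontrivial if its image is not contained in any prime (equivalently, maximal) ideal, equivalently if it maps strong units to strong units. The dual map of $\sigma$ sends a maximal ideal $\mathfrak{m}$ to $\sigma^{-1}[\mathfrak{m}]$. *)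

theory Defs
  imports "HOL-Analysis.Analysis" "HOL-Algebra.Congruence"
begin

record 'a hoop = "'a partial_object" +
  hplus :: "'a \<Rightarrow> 'a \<Rightarrow> 'a"
  hdiff :: "'a \<Rightarrow> 'a \<Rightarrow> 'a"
  hzero :: "'a"

locale cancellative_hoop =
  fixes H :: "('a, 'b) hoop_scheme"
  assumes zero_closed: "hzero H \<in> carrier H"
    and plus_closed: "\<lbrakk>a \<in> carrier H; b \<in> carrier H\<rbrakk> \<Longrightarrow> hplus H a b \<in> carrier H"
    and diff_closed: "\<lbrakk>a \<in> carrier H; b \<in> carrier H\<rbrakk> \<Longrightarrow> hdiff H a b \<in> carrier H"
    and plus_assoc: "\<lbrakk>a \<in> carrier H; b \<in> carrier H; c \<in> carrier H\<rbrakk>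
      \<Longrightarrow> hplus H (hplus H a b) c = hplus H a (hplus H b c)"
    and plus_comm: "\<lbrakk>a \<in> carrier H; b \<in> carrier H\<rbrakk> \<Longrightarrow> hplus H a b = hplus H b a"
    and plus_zero: "a \<in> carrier H \<Longrightarrow> hplus H a (hzero H) = a"
    and diff_self: "a \<in> carrier H \<Longrightarrow> hdiff H a a = hzero H"
    and diff_diff: "\<lbrakk>a \<in> carrier H; b \<in> carrier H; c \<in> carrier H\<rbrakk>
      \<Longrightarrow> hdiff H (hdiff H a b) c = hdiff H a (hplus H b c)"
    and plus_diff: "\<lbrakk>a \<in> carrier H; b \<in> carrier H\<rbrakk>
      \<Longrightarrow> hplus H a (hdiff H b a) = hplus H b (hdiff H a b)"
    and cancel: "\<lbrakk>a \<in> carrier H; b \<in> carrier H\<rbrakk> \<Longrightarrow> hdiff H (hplus H a b) b = a"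

definition hoop_le :: "('a, 'b) hoop_scheme \<Rightarrow> 'a \<Rightarrow> 'a \<Rightarrow> bool" where
  "hoop_le H a b \<longleftrightarrow> hdiff H a b = hzero H"

text \<open>The greatest lower bound of two elements in a hoop.\<close>

definition hoop_meet :: "('a, 'b) hoop_scheme \<Rightarrow> 'a \<Rightarrow> 'a \<Rightarrow> 'a" where
  "hoop_meet H a b = hdiff H a (hdiff H a b)"

definition hoop_multiple :: "('a, 'b) hoop_scheme \<Rightarrow> nat \<Rightarrow> 'a \<Rightarrow> 'a" where
  "hoop_multiple H k a = (hplus H a ^^ k) (hzero H)"

definition hoop_strong_unit :: "('a, 'b) hoop_scheme \<Rightarrow> 'a \<Rightarrow> bool" where
  "hoop_strong_unit H u \<longleftrightarrow>
     u \<in> carrier H \<and> (\<forall>a\<in>carrier H. \<exists>k. hoop_le H a (hoop_multiple H k u))"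

definition hoop_endo :: "('a, 'b) hoop_scheme \<Rightarrow> ('a \<Rightarrow> 'a) \<Rightarrow> bool" where
  "hoop_endo H \<sigma> \<longleftrightarrow>
     \<sigma> \<in> carrier H \<rightarrow> carrier H \<and>
     \<sigma> (hzero H) = hzero H \<and>
     (\<forall>a\<in>carrier H. \<forall>b\<in>carrier H.
        \<sigma> (hplus H a b) = hplus H (\<sigma> a) (\<sigma> b) \<and>
        \<sigma> (hdiff H a b) = hdiff H (\<sigma> a) (\<sigma> b))"

definition hoop_ideal :: "('a, 'b) hoop_scheme \<Rightarrow> 'a set \<Rightarrow> bool" where
  "hoop_ideal H I \<longleftrightarrow>
     I \<subseteq> carrier H \<and> hzero H \<in> I \<and>
     (\<forall>a\<in>I. \<forall>b\<in>I. hplus H a b \<in> I) \<and>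
     (\<forall>a\<in>carrier H. \<forall>b\<in>I. hoop_le H a b \<longrightarrow> a \<in> I)"

definition hoop_prime_ideal :: "('a, 'b) hoop_scheme \<Rightarrow> 'a set \<Rightarrow> bool" where
  "hoop_prime_ideal H I \<longleftrightarrow>
     hoop_ideal H I \<and> I \<noteq> carrier H \<and>
     (\<forall>a\<in>carrier H. \<forall>b\<in>carrier H. hoop_meet H a b \<in> I \<longrightarrow> a \<in> I \<or> b \<in> I)"

definition hoop_max_spec :: "('a, 'b) hoop_scheme \<Rightarrow> 'a set set" where
  "hoop_max_spec H =
     {M. hoop_ideal H M \<and> M \<noteq> carrier H \<and>
         (\<forall>I. hoop_ideal H I \<and> M \<subseteq> I \<and> I \<noteq> carrier H \<longrightarrow> I = M)}"

definition hoop_nontrivial_endo :: "('a, 'b) hoop_scheme \<Rightarrow> ('a \<Rightarrow> 'a) \<Rightarrow> bool" where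
  "hoop_nontrivial_endo H \<sigma> \<longleftrightarrow>
     hoop_endo H \<sigma> \<and> \<not> (\<exists>I. hoop_prime_ideal H I \<and> \<sigma> ` carrier H \<subseteq> I)"

definition hoop_dual :: "('a, 'b) hoop_scheme \<Rightarrow> ('a \<Rightarrow> 'a) \<Rightarrow> 'a set \<Rightarrow> 'a set" where
  "hoop_dual H \<sigma> M = {a \<in> carrier H. \<sigma> a \<in> M}"

text \<open>The dimension \<open>n - 1 \<ge> 1\<close> is the cardinality of the finite index type \<open>'d\<close>.
  Functions on the unit cube are taken to be \<^const>\<open>undefined\<close> outside the cube, so that
  equality of functions is equality on the cube.\<close>

definition unit_cube :: "(real ^ 'd) set" where
  "unit_cube = {p. \<forall>i. 0 \<le> p $ i \<and> p $ i \<le> 1}"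

definition mcnaughton :: "(real ^ 'd \<Rightarrow> real) set" where
  "mcnaughton =
     {f \<in> extensional unit_cube. continuous_on unit_cube f \<and>
        (\<exists>P :: (('d \<Rightarrow> int) \<times> int) set. finite P \<and>
           (\<forall>p\<in>unit_cube. \<exists>(a, b)\<in>P.
              f p = (\<Sum>i\<in>UNIV. of_int (a i) * p $ i) + of_int b))}"

text \<open>The positive cone of the lattice-ordered group of all McNaughton functions.  It is the
  free cancellative hoop over \<open>CARD('d) + 1\<close> generators, freely generated by the
  functions \<open>coord i\<close> together with \<open>last_gen\<close> below.\<close>

definition mcn_hoop :: "(real ^ 'd \<Rightarrow> real) hoop" where
  "mcn_hoop =
     \<lparr> carrier = {f \<in> mcnaughton. \<forall>p\<in>unit_cube. 0 \<le> f p},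
       hplus = (\<lambda>f g. \<lambda>p\<in>unit_cube. f p + g p),
       hdiff = (\<lambda>f g. \<lambda>p\<in>unit_cube. max 0 (f p - g p)),
       hzero = (\<lambda>p\<in>unit_cube. 0) \<rparr>"

definition one_fun :: "real ^ 'd \<Rightarrow> real" where
  "one_fun = (\<lambda>p\<in>unit_cube. 1)"

definition coord :: "'d \<Rightarrow> real ^ 'd \<Rightarrow> real" where
  "coord i = (\<lambda>p\<in>unit_cube. p $ i)"

definition last_gen :: "real ^ 'd::finite \<Rightarrow> real" where
  "last_gen = (\<lambda>p\<in>unit_cube. 1 - Max (range (\<lambda>i. p $ i)))"

definition point_ideal :: "real ^ 'd \<Rightarrow> (real ^ 'd \<Rightarrow> real) set" where
  "point_ideal p = {f \<in> carrier mcn_hoop. f p = 0}"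

lemma mcnaughtonI:
  fixes f :: "real ^ 'd \<Rightarrow> real"
  assumes "f \<in> extensional unit_cube" "continuous_on unit_cube f" "finite P"
    and "\<And>p. p \<in> unit_cube \<Longrightarrow>
      \<exists>a b. (a, b) \<in> P \<and> f p = (\<Sum>i\<in>UNIV. of_int (a i) * p $ i) + of_int b"
  shows "f \<in> mcnaughton"
proof -
  have "\<forall>p\<in>unit_cube. \<exists>(a, b)\<in>P. f p = (\<Sum>i\<in>UNIV. of_int (a i) * p $ i) + of_int b"
    using assms(4) by (simp only: split_beta Bex_def split_paired_Ex fst_conv snd_conv Ball_def) simp
  then show ?thesis
    unfolding mcnaughton_def using assms(1-3) by (intro CollectI conjI exI[of _ P])
qed

lemma mcnaughtonE:
  fixes f :: "real ^ 'd \<Rightarrow> real"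
  assumes "f \<in> mcnaughton"
  obtains P where "finite P" and "\<And>p. p \<in> unit_cube \<Longrightarrow>
      \<exists>a b. (a, b) \<in> P \<and> f p = (\<Sum>i\<in>UNIV. of_int (a i) * p $ i) + of_int b"
proof -
  from assms obtain P where P: "finite P"
    "\<forall>p\<in>unit_cube. \<exists>(a, b)\<in>P. f p = (\<Sum>i\<in>UNIV. of_int (a i) * p $ i) + of_int b"
    unfolding mcnaughton_def by (elim CollectE conjE exE)
  have "\<exists>a b. (a, b) \<in> P \<and> f p = (\<Sum>i\<in>UNIV. of_int (a i) * p $ i) + of_int b"
    if "p \<in> unit_cube" for p
    using bspec[OF P(2) that] by (elim bexE) (simp only: split_beta, metis prod.collapse)
  with P(1) show thesis by (rule that)
qed

lemma mcnaughton_cont: "f \<in> mcnaughton \<Longrightarrow> continuous_on unit_cube f"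
  by (simp add: mcnaughton_def)

lemma mcnaughton_ext: "f \<in> mcnaughton \<Longrightarrow> f \<in> extensional unit_cube"
  by (simp add: mcnaughton_def)

lemma mcnaughton_affine:
  fixes a :: "'d::finite \<Rightarrow> int"
  shows "(\<lambda>p\<in>unit_cube. (\<Sum>i\<in>UNIV. of_int (a i) * p $ i) + of_int b) \<in> mcnaughton"
proof (rule mcnaughtonI[where P = "{(a, b)}"])
  have "continuous_on unit_cube (\<lambda>p. (\<Sum>i\<in>UNIV. of_int (a i) * p $ i) + real_of_int b)"
    by (intro continuous_intros)
  then show "continuous_on unit_cube
      (\<lambda>p\<in>unit_cube. (\<Sum>i\<in>UNIV. of_int (a i) * p $ i) + real_of_int b)"
    by (rule continuous_on_eq) simp
qed auto

lemma mcnaughton_add: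
  fixes f g :: "real ^ 'd::finite \<Rightarrow> real"
  assumes f: "f \<in> mcnaughton" and g: "g \<in> mcnaughton"
  shows "(\<lambda>p\<in>unit_cube. f p + g p) \<in> mcnaughton"
proof -
  obtain P where P: "finite P" "\<And>p. p \<in> unit_cube \<Longrightarrow>
      \<exists>a b. (a, b) \<in> P \<and> f p = (\<Sum>i\<in>UNIV. of_int (a i) * p $ i) + of_int b"
    using mcnaughtonE[OF f] by blast
  obtain Q where Q: "finite Q" "\<And>p. p \<in> unit_cube \<Longrightarrow>
      \<exists>a b. (a, b) \<in> Q \<and> g p = (\<Sum>i\<in>UNIV. of_int (a i) * p $ i) + of_int b"
    using mcnaughtonE[OF g] by blast
  let ?R = "(\<lambda>((a, b), (a', b')). (\<lambda>i. a i + a' i, b + b')) ` (P \<times> Q)"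
  show ?thesis
  proof (rule mcnaughtonI[where P = ?R])
    have "continuous_on unit_cube (\<lambda>p. f p + g p)"
      using f g by (intro continuous_intros mcnaughton_cont)
    then show "continuous_on unit_cube (\<lambda>p\<in>unit_cube. f p + g p)"
      by (rule continuous_on_eq) simp
    show "finite ?R" using P(1) Q(1) by simp
  next
    fix p :: "real ^ 'd" assume p: "p \<in> unit_cube"
    obtain a b where ab: "(a, b) \<in> P" "f p = (\<Sum>i\<in>UNIV. of_int (a i) * p $ i) + of_int b"
      using P(2)[OF p] by blast
    obtain a' b' where ab': "(a', b') \<in> Q" "g p = (\<Sum>i\<in>UNIV. of_int (a' i) * p $ i) + of_int b'"
      using Q(2)[OF p] by blast
    have "(\<lambda>i. a i + a' i, b + b') \<in> ?R"
      using ab(1) ab'(1) by (intro image_eqI[where x = "((a, b), (a', b'))"]) simp_all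
    moreover have "(\<lambda>p\<in>unit_cube. f p + g p) p
        = (\<Sum>i\<in>UNIV. of_int (a i + a' i) * p $ i) + of_int (b + b')"
      using p ab(2) ab'(2) by (simp add: algebra_simps sum.distrib)
    ultimately show "\<exists>a b. (a, b) \<in> ?R \<and> (\<lambda>p\<in>unit_cube. f p + g p) p
        = (\<Sum>i\<in>UNIV. of_int (a i) * p $ i) + of_int b"
      by blast
  qed simp
qed

lemma mcnaughton_neg:
  fixes f :: "real ^ 'd::finite \<Rightarrow> real"
  assumes f: "f \<in> mcnaughton"
  shows "(\<lambda>p\<in>unit_cube. - f p) \<in> mcnaughton"
proof -
  obtain P where P: "finite P" "\<And>p. p \<in> unit_cube \<Longrightarrow>
      \<exists>a b. (a, b) \<in> P \<and> f p = (\<Sum>i\<in>UNIV. of_int (a i) * p $ i) + of_int b"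
    using mcnaughtonE[OF f] by blast
  let ?R = "(\<lambda>(a, b). (\<lambda>i. - a i, - b)) ` P"
  show ?thesis
  proof (rule mcnaughtonI[where P = ?R])
    have "continuous_on unit_cube (\<lambda>p. - f p)"
      using f by (intro continuous_intros mcnaughton_cont)
    then show "continuous_on unit_cube (\<lambda>p\<in>unit_cube. - f p)"
      by (rule continuous_on_eq) simp
    show "finite ?R" using P(1) by simp
  next
    fix p :: "real ^ 'd" assume p: "p \<in> unit_cube"
    obtain a b where ab: "(a, b) \<in> P" "f p = (\<Sum>i\<in>UNIV. of_int (a i) * p $ i) + of_int b"
      using P(2)[OF p] by blast
    have "(\<lambda>i. - a i, - b) \<in> ?R"
      using ab(1) by (intro image_eqI[where x = "(a, b)"]) simp_all
    moreover have "(\<lambda>p\<in>unit_cube. - f p) p = (\<Sum>i\<in>UNIV. of_int (- a i) * p $ i) + of_int (- b)"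
      using p ab(2) by (simp add: sum_negf)
    ultimately show "\<exists>a b. (a, b) \<in> ?R \<and> (\<lambda>p\<in>unit_cube. - f p) p
        = (\<Sum>i\<in>UNIV. of_int (a i) * p $ i) + of_int b"
      by blast
  qed simp
qed

lemma mcnaughton_max:
  fixes f g :: "real ^ 'd::finite \<Rightarrow> real"
  assumes f: "f \<in> mcnaughton" and g: "g \<in> mcnaughton"
  shows "(\<lambda>p\<in>unit_cube. max (f p) (g p)) \<in> mcnaughton"
proof -
  obtain P where P: "finite P" "\<And>p. p \<in> unit_cube \<Longrightarrow>
      \<exists>a b. (a, b) \<in> P \<and> f p = (\<Sum>i\<in>UNIV. of_int (a i) * p $ i) + of_int b"
    using mcnaughtonE[OF f] by blast
  obtain Q where Q: "finite Q" "\<And>p. p \<in> unit_cube \<Longrightarrow>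
      \<exists>a b. (a, b) \<in> Q \<and> g p = (\<Sum>i\<in>UNIV. of_int (a i) * p $ i) + of_int b"
    using mcnaughtonE[OF g] by blast
  show ?thesis
  proof (rule mcnaughtonI[where P = "P \<union> Q"])
    have "continuous_on unit_cube (\<lambda>p. max (f p) (g p))"
      using f g by (intro continuous_intros mcnaughton_cont)
    then show "continuous_on unit_cube (\<lambda>p\<in>unit_cube. max (f p) (g p))"
      by (rule continuous_on_eq) simp
    show "finite (P \<union> Q)" using P(1) Q(1) by simp
  next
    fix p :: "real ^ 'd" assume p: "p \<in> unit_cube"
    have "(\<lambda>p\<in>unit_cube. max (f p) (g p)) p = f p \<or> (\<lambda>p\<in>unit_cube. max (f p) (g p)) p = g p"
      using p by (simp add: max_def)
    then show "\<exists>a b. (a, b) \<in> P \<union> Q \<and> (\<lambda>p\<in>unit_cube. max (f p) (g p)) p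
        = (\<Sum>i\<in>UNIV. of_int (a i) * p $ i) + of_int b"
      using P(2)[OF p] Q(2)[OF p] by (metis UnI1 UnI2)
  qed simp
qed

lemma mcnaughton_const:
  "(\<lambda>p\<in>unit_cube. of_int b) \<in> (mcnaughton :: (real ^ 'd::finite \<Rightarrow> real) set)"
  using mcnaughton_affine[of "\<lambda>_. 0" b] by simp

lemma mcn_hoop_simps [simp]:
  "carrier mcn_hoop = {f \<in> mcnaughton. \<forall>p\<in>unit_cube. 0 \<le> f p}"
  "hplus mcn_hoop = (\<lambda>f g. \<lambda>p\<in>unit_cube. f p + g p)"
  "hdiff mcn_hoop = (\<lambda>f g. \<lambda>p\<in>unit_cube. max 0 (f p - g p))"
  "hzero mcn_hoop = (\<lambda>p\<in>unit_cube. 0)"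
  by (simp_all add: mcn_hoop_def)

theorem mcn_hoop_cancellative:
  "cancellative_hoop (mcn_hoop :: (real ^ 'd::finite \<Rightarrow> real) hoop)"
proof
  let ?H = "mcn_hoop :: (real ^ 'd \<Rightarrow> real) hoop"
  show "hzero ?H \<in> carrier ?H"
    using mcnaughton_const[of 0] by simp
  fix f g h assume f: "f \<in> carrier ?H"
  have undef: "f p = undefined" if "p \<notin> unit_cube" for p
    using f that mcnaughton_ext[of f] by (simp add: extensional_def)
  show "hplus ?H f (hzero ?H) = f"
    using undef by (simp add: fun_eq_iff restrict_def)
  show "hdiff ?H f f = hzero ?H"
    by (simp add: fun_eq_iff restrict_def)
  assume g: "g \<in> carrier ?H"
  show "hplus ?H f g \<in> carrier ?H"
    using f g mcnaughton_add[of f g] by simp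
  have "(\<lambda>p\<in>unit_cube. f p + (\<lambda>p\<in>unit_cube. - g p) p) \<in> mcnaughton"
    using mcnaughton_add[of f "\<lambda>p\<in>unit_cube. - g p"] mcnaughton_neg[of g] f g by simp
  from mcnaughton_max[OF mcnaughton_const[of 0] this]
  have "(\<lambda>p\<in>unit_cube. max 0 (f p - g p)) \<in> mcnaughton"
    by (rule back_subst[where P = "\<lambda>h. h \<in> mcnaughton"]) (simp add: fun_eq_iff restrict_def)
  then show "hdiff ?H f g \<in> carrier ?H"
    by simp
  show "hplus ?H f g = hplus ?H g f"
    by (simp add: add.commute)
  show "hplus ?H f (hdiff ?H g f) = hplus ?H g (hdiff ?H f g)"
    by (simp add: fun_eq_iff restrict_def max_def)
  show "hdiff ?H (hplus ?H f g) g = f"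
    using f undef by (simp add: fun_eq_iff restrict_def)
  assume h: "h \<in> carrier ?H"
  show "hplus ?H (hplus ?H f g) h = hplus ?H f (hplus ?H g h)"
    by (simp add: fun_eq_iff restrict_def)
  have "max 0 (max 0 (f p - g p) - h p) = max 0 (f p - (g p + h p))" if "p \<in> unit_cube" for p
    using h that by (auto simp: max_def)
  then show "hdiff ?H (hdiff ?H f g) h = hdiff ?H f (hplus ?H g h)"
    by (simp add: fun_eq_iff restrict_def)
qed

end

theory Submission
  imports Defs
begin

text \<open>Two real-valued homomorphisms \<open>\<phi>\<close>, \<open>\<psi>\<close> of a cancellative hoop with
  \<open>ker \<phi> \<subseteq> ker \<psi>\<close> are proportional: \<open>\<psi> b < \<psi> a\<close> says that the truncated difference of \<open>a\<close>
  and \<open>b\<close> is not in \<open>ker \<psi>\<close>, hence not in \<open>ker \<phi>\<close>, so that \<open>\<phi> b < \<phi> a\<close>; applying this to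
  multiples of \<open>a\<close> and \<open>b\<close> compares the ratios, as in Hoelder's theorem. By compactness of the
  cube, the kernel of every nonzero \<open>\<phi>\<close> on the McNaughton functions lies in the kernel of the
  evaluation at some point \<open>q\<close>, so \<open>\<phi> h = \<phi> \<one> * h q\<close>. For the homomorphism
  \<open>h \<mapsto> \<sigma> h p\<close> the coordinate functions show that \<open>q = S p\<close>. This avoids the theorem that the
  McNaughton functions are generated by \<open>x\<^sub>1, \<dots>, x\<^sub>n\<close>.\<close>

lemma nat_fraction_between:
  fixes x y :: real
  assumes "0 \<le> x" "x < y"
  obtains m k :: nat where "real k * x < real m" "real m < real k * y"
proof -
  obtain r where r: "r \<in> \<rat>" "x < r" "r < y"
    using Rats_dense_in_real[OF \<open>x < y\<close>] by blast
  obtain m k :: nat where "k \<noteq> 0" "\<bar>r\<bar> = real m / real k"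
    using Rats_abs_nat_div_natE[OF r(1)] by metis
  with r assms(1) have "k > 0" "real m = real k * r"
    by (auto simp: field_simps)
  with r show thesis
    by (intro that[of k m]) auto
qed


section \<open>Ideals and real-valued homomorphisms of cancellative hoops\<close>

abbreviation hoop_proper_ideal :: "('a, 'b) hoop_scheme \<Rightarrow> 'a set \<Rightarrow> bool" where
  "hoop_proper_ideal H I \<equiv> hoop_ideal H I \<and> I \<noteq> carrier H"

definition hoop_real_hom :: "('a, 'b) hoop_scheme \<Rightarrow> ('a \<Rightarrow> real) \<Rightarrow> bool" where
  "hoop_real_hom H \<phi> \<longleftrightarrow>
     (\<forall>a\<in>carrier H. \<forall>b\<in>carrier H.
        \<phi> (hplus H a b) = \<phi> a + \<phi> b \<and> \<phi> (hdiff H a b) = max 0 (\<phi> a - \<phi> b))"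

definition hoop_kernel :: "('a, 'b) hoop_scheme \<Rightarrow> ('a \<Rightarrow> real) \<Rightarrow> 'a set" where
  "hoop_kernel H \<phi> = {a \<in> carrier H. \<phi> a = 0}"

lemma bij_betw_hoop_max_spec:
  assumes proper: "\<And>x. x \<in> X \<Longrightarrow> hoop_proper_ideal H (J x)"
    and cover: "\<And>I. hoop_proper_ideal H I \<Longrightarrow> \<exists>x\<in>X. I \<subseteq> J x"
    and antichain: "\<And>x y. x \<in> X \<Longrightarrow> y \<in> X \<Longrightarrow> J x \<subseteq> J y \<Longrightarrow> x = y"
  shows "bij_betw J X (hoop_max_spec H)"
proof (rule bij_betwI')
  fix x y assume "x \<in> X" "y \<in> X"
  then show "(J x = J y) = (x = y)"
    using antichain by blast
next
  fix x assume x: "x \<in> X"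
  have "I = J x" if I: "hoop_proper_ideal H I" "J x \<subseteq> I" for I
  proof -
    obtain y where "y \<in> X" "I \<subseteq> J y"
      using cover[OF I(1)] by blast
    with x I(2) antichain[of x y] show ?thesis by blast
  qed
  with proper[OF x] show "J x \<in> hoop_max_spec H"
    unfolding hoop_max_spec_def by blast
next
  fix M assume M: "M \<in> hoop_max_spec H"
  then have M_proper: "hoop_proper_ideal H M"
    and M_max: "\<And>I. hoop_proper_ideal H I \<Longrightarrow> M \<subseteq> I \<Longrightarrow> I = M"
    by (auto simp: hoop_max_spec_def)
  obtain x where x: "x \<in> X" "M \<subseteq> J x"
    using cover[OF M_proper] by blast
  then show "\<exists>x\<in>X. M = J x"
    using M_max[OF proper[OF x(1)] x(2)] by blast
qed

lemma hoop_multiple_0 [simp]: "hoop_multiple H 0 a = hzero H"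
  by (simp add: hoop_multiple_def)

lemma hoop_multiple_Suc [simp]: "hoop_multiple H (Suc k) a = hplus H a (hoop_multiple H k a)"
  by (simp add: hoop_multiple_def)

lemma ideal_multiple_mem:
  assumes "hoop_ideal H I" "a \<in> I"
  shows "hoop_multiple H k a \<in> I"
  using assms by (induction k) (auto simp: hoop_ideal_def)

lemma ideal_eq_carrier_if_strong_unit_mem:
  assumes I: "hoop_ideal H I" and u: "u \<in> I" "hoop_strong_unit H u"
  shows "I = carrier H"
proof
  show "I \<subseteq> carrier H" using I by (simp add: hoop_ideal_def)
  show "carrier H \<subseteq> I"
  proof
    fix a assume a: "a \<in> carrier H"
    with u(2) obtain k where "hoop_le H a (hoop_multiple H k u)"
      by (auto simp: hoop_strong_unit_def)
    with I ideal_multiple_mem[OF I u(1)] a show "a \<in> I"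
      unfolding hoop_ideal_def by blast
  qed
qed

lemma nontrivial_endo_imp_endo: "hoop_nontrivial_endo H \<sigma> \<Longrightarrow> hoop_endo H \<sigma>"
  by (simp add: hoop_nontrivial_endo_def)

lemma endo_closed: "hoop_endo H \<sigma> \<Longrightarrow> a \<in> carrier H \<Longrightarrow> \<sigma> a \<in> carrier H"
  by (auto simp: hoop_endo_def)

lemma real_hom_comp_endo:
  assumes "hoop_real_hom H \<phi>" "hoop_endo H \<sigma>"
  shows "hoop_real_hom H (\<lambda>a. \<phi> (\<sigma> a))"
  using assms endo_closed[OF assms(2)] by (simp add: hoop_real_hom_def hoop_endo_def)

lemma hoop_dual_kernel:
  "hoop_endo H \<sigma> \<Longrightarrow> hoop_dual H \<sigma> (hoop_kernel H \<phi>) = hoop_kernel H (\<lambda>a. \<phi> (\<sigma> a))"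
  by (auto simp: hoop_dual_def hoop_kernel_def endo_closed)

context cancellative_hoop
begin

lemma diff_zero: "a \<in> carrier H \<Longrightarrow> hdiff H a (hzero H) = a"
  using cancel[of a "hzero H"] by (simp add: plus_zero zero_closed)

lemma zero_diff:
  assumes a: "a \<in> carrier H"
  shows "hdiff H (hzero H) a = hzero H"
proof -
  have "hplus H (hdiff H (hzero H) a) a = hplus H a (hdiff H (hzero H) a)"
    using a by (intro plus_comm diff_closed zero_closed)
  also have "\<dots> = hplus H (hzero H) (hdiff H a (hzero H))"
    using a by (intro plus_diff zero_closed)
  also have "\<dots> = a"
    using a by (simp add: diff_zero plus_comm[of "hzero H"] plus_zero zero_closed)
  finally show ?thesis
    using a cancel[of "hdiff H (hzero H) a" a] by (simp add: diff_closed diff_self zero_closed)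
qed

lemma hoop_le_plus: "a \<in> carrier H \<Longrightarrow> b \<in> carrier H \<Longrightarrow> hoop_le H a (hplus H a b)"
  using diff_diff[of a a b] by (simp add: hoop_le_def diff_self zero_diff)

lemma hoop_leE:
  assumes "a \<in> carrier H" "b \<in> carrier H" "hoop_le H a b"
  obtains c where "c \<in> carrier H" "b = hplus H a c"
proof
  show "hdiff H b a \<in> carrier H"
    using assms by (intro diff_closed)
  show "b = hplus H a (hdiff H b a)"
    using plus_diff[of a b] assms by (simp add: hoop_le_def plus_zero)
qed

lemma hoop_le_plus_right:
  assumes "a \<in> carrier H" "b \<in> carrier H" "c \<in> carrier H" "hoop_le H a b"
  shows "hoop_le H a (hplus H b c)"
proof -
  obtain d where d: "d \<in> carrier H" "b = hplus H a d"
    using hoop_leE assms(1,2,4) by blast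
  with assms show ?thesis
    using hoop_le_plus[of a "hplus H d c"] by (simp add: plus_assoc plus_closed)
qed

lemma multiple_closed: "a \<in> carrier H \<Longrightarrow> hoop_multiple H k a \<in> carrier H"
  by (induction k) (simp_all add: zero_closed plus_closed)

lemma ideal_finite_upper_bound:
  assumes I: "hoop_ideal H I" and "finite F" "F \<subseteq> I"
  shows "\<exists>u\<in>I. \<forall>a\<in>F. hoop_le H a u"
  using assms(2,3)
proof (induction F rule: finite_induct)
  case empty
  then show ?case using I by (auto simp: hoop_ideal_def)
next
  case (insert b F)
  then obtain u where u: "u \<in> I" "\<forall>a\<in>F. hoop_le H a u"
    by auto
  have carrier: "b \<in> carrier H" "u \<in> carrier H" "F \<subseteq> carrier H"
    using I insert.prems u(1) by (auto simp: hoop_ideal_def)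
  have "\<forall>a\<in>F. hoop_le H a (hplus H u b)"
    using u(2) carrier by (blast intro: hoop_le_plus_right)
  moreover have "hoop_le H b (hplus H u b)"
    using carrier hoop_le_plus[of b u] by (simp add: plus_comm)
  moreover have "hplus H u b \<in> I"
    using I u(1) insert.prems by (simp add: hoop_ideal_def)
  ultimately show ?case by blast
qed

lemma real_hom_nonneg: "hoop_real_hom H \<phi> \<Longrightarrow> a \<in> carrier H \<Longrightarrow> 0 \<le> \<phi> a"
  by (metis diff_zero hoop_real_hom_def max.cobounded1 zero_closed)

lemma real_hom_zero: "hoop_real_hom H \<phi> \<Longrightarrow> \<phi> (hzero H) = 0"
  using zero_closed plus_zero[OF zero_closed] unfolding hoop_real_hom_def
  by (metis add_cancel_right_right)

lemma real_hom_mono: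
  assumes \<phi>: "hoop_real_hom H \<phi>" and "a \<in> carrier H" "b \<in> carrier H" "hoop_le H a b"
  shows "\<phi> a \<le> \<phi> b"
proof -
  obtain c where "c \<in> carrier H" "b = hplus H a c"
    using hoop_leE assms(2-4) by blast
  with assms show ?thesis
    using real_hom_nonneg[OF \<phi>, of c] by (simp add: hoop_real_hom_def)
qed

lemma real_hom_multiple:
  assumes \<phi>: "hoop_real_hom H \<phi>" and a: "a \<in> carrier H"
  shows "\<phi> (hoop_multiple H k a) = real k * \<phi> a"
proof (induction k)
  case 0
  show ?case by (simp add: real_hom_zero[OF \<phi>])
next
  case (Suc k)
  then show ?case
    using \<phi> a multiple_closed[OF a] by (simp add: hoop_real_hom_def algebra_simps)
qed

lemma real_hom_kernel_ideal:
  assumes \<phi>: "hoop_real_hom H \<phi>"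
  shows "hoop_ideal H (hoop_kernel H \<phi>)"
  unfolding hoop_ideal_def
proof (intro conjI ballI impI)
  fix a b assume "a \<in> carrier H" "b \<in> hoop_kernel H \<phi>" "hoop_le H a b"
  then show "a \<in> hoop_kernel H \<phi>"
    using real_hom_mono[OF \<phi>, of a b] real_hom_nonneg[OF \<phi>, of a] by (auto simp: hoop_kernel_def)
next
  fix a b assume "a \<in> hoop_kernel H \<phi>" "b \<in> hoop_kernel H \<phi>"
  with \<phi> show "hplus H a b \<in> hoop_kernel H \<phi>"
    by (simp add: hoop_kernel_def hoop_real_hom_def plus_closed)
qed (auto simp: hoop_kernel_def zero_closed real_hom_zero[OF \<phi>])

lemma real_hom_meet:
  assumes "hoop_real_hom H \<phi>" "a \<in> carrier H" "b \<in> carrier H"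
  shows "\<phi> (hoop_meet H a b) = min (\<phi> a) (\<phi> b)"
proof -
  have "\<phi> (hoop_meet H a b) = max 0 (\<phi> a - max 0 (\<phi> a - \<phi> b))"
    using assms by (simp add: hoop_real_hom_def hoop_meet_def diff_closed)
  also have "\<dots> = min (\<phi> a) (\<phi> b)"
    using assms real_hom_nonneg by (auto simp: max_def min_def)
  finally show ?thesis .
qed

lemma real_hom_kernel_prime:
  assumes \<phi>: "hoop_real_hom H \<phi>" and u: "u \<in> carrier H" "\<phi> u \<noteq> 0"
  shows "hoop_prime_ideal H (hoop_kernel H \<phi>)"
  unfolding hoop_prime_ideal_def
proof (intro conjI ballI impI real_hom_kernel_ideal[OF \<phi>])
  show "hoop_kernel H \<phi> \<noteq> carrier H"
    using u by (auto simp: hoop_kernel_def)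
  fix a b assume "a \<in> carrier H" "b \<in> carrier H" "hoop_meet H a b \<in> hoop_kernel H \<phi>"
  then show "a \<in> hoop_kernel H \<phi> \<or> b \<in> hoop_kernel H \<phi>"
    using real_hom_meet[OF \<phi>, of a b] by (auto simp: hoop_kernel_def min_def split: if_splits)
qed

lemma real_hom_less_if_kernel_subset:
  assumes \<phi>: "hoop_real_hom H \<phi>" and \<psi>: "hoop_real_hom H \<psi>"
    and ker: "hoop_kernel H \<phi> \<subseteq> hoop_kernel H \<psi>"
    and ab: "a \<in> carrier H" "b \<in> carrier H" and less: "\<psi> b < \<psi> a"
  shows "\<phi> b < \<phi> a"
proof -
  have "\<psi> (hdiff H a b) \<noteq> 0"
    using \<psi> ab less by (simp add: hoop_real_hom_def)
  then have "\<phi> (hdiff H a b) \<noteq> 0"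
    using ker diff_closed[OF ab] unfolding hoop_kernel_def by blast
  then show ?thesis
    using \<phi> ab by (auto simp: hoop_real_hom_def)
qed

theorem real_hom_proportional:
  assumes \<phi>: "hoop_real_hom H \<phi>" and \<psi>: "hoop_real_hom H \<psi>"
    and ker: "hoop_kernel H \<phi> \<subseteq> hoop_kernel H \<psi>"
    and a: "a \<in> carrier H" and b: "b \<in> carrier H"
  shows "\<phi> a * \<psi> b = \<phi> b * \<psi> a"
proof -
  note less = real_hom_less_if_kernel_subset[OF \<phi> \<psi> ker]
  have "\<phi> b * \<psi> a \<le> \<phi> a * \<psi> b" if a: "a \<in> carrier H" and b: "b \<in> carrier H" for a b
  proof (rule ccontr)
    assume gt: "\<not> ?thesis"
    have nonneg: "0 \<le> \<phi> a" "0 \<le> \<phi> b" "0 \<le> \<psi> a" "0 \<le> \<psi> b"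
      using real_hom_nonneg \<phi> \<psi> a b by auto
    with gt have "\<psi> a > 0"
      by (cases "\<psi> a = 0") auto
    then have "\<phi> a > 0"
      using less[OF a zero_closed] by (simp add: real_hom_zero \<phi> \<psi>)
    have "\<psi> b / \<psi> a < \<phi> b / \<phi> a"
      using gt \<open>\<psi> a > 0\<close> \<open>\<phi> a > 0\<close> by (simp add: field_simps)
    moreover have "0 \<le> \<psi> b / \<psi> a"
      using nonneg by simp
    ultimately obtain m k :: nat
      where "real k * (\<psi> b / \<psi> a) < real m" "real m < real k * (\<phi> b / \<phi> a)"
      using nat_fraction_between by blast
    then have "real k * \<psi> b < real m * \<psi> a" and "real m * \<phi> a < real k * \<phi> b"
      using \<open>\<psi> a > 0\<close> \<open>\<phi> a > 0\<close> by (simp_all add: field_simps)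
    with less[OF multiple_closed[OF a] multiple_closed[OF b], of k m] show False
      by (simp add: real_hom_multiple \<phi> \<psi> a b)
  qed
  from this[OF a b] this[OF b a] show ?thesis by simp
qed

theorem nontrivial_endo_strong_unit_neq_0:
  assumes \<sigma>: "hoop_nontrivial_endo H \<sigma>" and u: "hoop_strong_unit H u"
    and \<phi>: "hoop_real_hom H \<phi>" and a: "a \<in> carrier H" "\<phi> a \<noteq> 0"
  shows "\<phi> (\<sigma> u) \<noteq> 0"
proof
  note endo = nontrivial_endo_imp_endo[OF \<sigma>]
  assume "\<phi> (\<sigma> u) = 0"
  then have "u \<in> hoop_kernel H (\<lambda>a. \<phi> (\<sigma> a))"
    using u by (simp add: hoop_kernel_def hoop_strong_unit_def)
  then have "hoop_kernel H (\<lambda>a. \<phi> (\<sigma> a)) = carrier H"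
    using real_hom_kernel_ideal[OF real_hom_comp_endo[OF \<phi> endo]] u
    by (intro ideal_eq_carrier_if_strong_unit_mem)
  then have "\<sigma> ` carrier H \<subseteq> hoop_kernel H \<phi>"
    using endo_closed[OF endo] by (auto simp: hoop_kernel_def)
  with \<sigma> real_hom_kernel_prime[OF \<phi> a] show False
    unfolding hoop_nontrivial_endo_def by blast
qed

end


section \<open>Maximal ideals of the hoop of McNaughton functions\<close>

interpretation mcn: cancellative_hoop "mcn_hoop :: (real ^ 'd::finite \<Rightarrow> real) hoop"
  by (rule mcn_hoop_cancellative)

declare mcn_hoop_simps [simp del]

lemma mcn_plus_apply [simp]: "p \<in> unit_cube \<Longrightarrow> hplus mcn_hoop f g p = f p + g p"
  by (simp add: mcn_hoop_simps)

lemma mcn_diff_apply [simp]: "p \<in> unit_cube \<Longrightarrow> hdiff mcn_hoop f g p = max 0 (f p - g p)"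
  by (simp add: mcn_hoop_simps)

lemma one_fun_apply [simp]: "p \<in> unit_cube \<Longrightarrow> one_fun p = 1"
  by (simp add: one_fun_def)

lemma coord_apply [simp]: "p \<in> unit_cube \<Longrightarrow> coord i p = p $ i"
  by (simp add: coord_def)

lemma last_gen_apply [simp]: "p \<in> unit_cube \<Longrightarrow> last_gen p = 1 - Max (range (\<lambda>i. p $ i))"
  by (simp add: last_gen_def)

lemma mcn_extensional: "f \<in> carrier mcn_hoop \<Longrightarrow> f \<in> extensional unit_cube"
  by (simp add: mcn_hoop_simps mcnaughton_ext)

lemma mcn_continuous_on: "f \<in> carrier mcn_hoop \<Longrightarrow> continuous_on unit_cube f"
  by (simp add: mcn_hoop_simps mcnaughton_cont)

lemma hoop_le_mcn_iff: "hoop_le mcn_hoop f g \<longleftrightarrow> (\<forall>p\<in>unit_cube. f p \<le> g p)"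
  by (auto simp: hoop_le_def mcn_hoop_simps fun_eq_iff restrict_def max_def)
    (metis linorder_le_cases)

lemma evaluation_real_hom: "p \<in> unit_cube \<Longrightarrow> hoop_real_hom mcn_hoop (\<lambda>f. f p)"
  by (simp add: hoop_real_hom_def)

lemmas mcn_nonneg = mcn.real_hom_nonneg[OF evaluation_real_hom]

lemma point_ideal_eq_kernel: "point_ideal p = hoop_kernel mcn_hoop (\<lambda>f. f p)"
  by (simp add: point_ideal_def hoop_kernel_def)

lemma one_fun_carrier: "one_fun \<in> carrier (mcn_hoop :: (real ^ 'd::finite \<Rightarrow> real) hoop)"
  using mcnaughton_const[of 1] by (simp add: one_fun_def mcn_hoop_simps)

lemma coord_carrier: "coord i \<in> carrier (mcn_hoop :: (real ^ 'd::finite \<Rightarrow> real) hoop)"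
proof -
  have "(\<Sum>j\<in>UNIV. of_int (if j = i then 1 else 0) * p $ j) = p $ i" for p :: "real ^ 'd"
    by (simp add: if_distrib if_distribR cong: if_cong)
  with mcnaughton_affine[of "\<lambda>j. if j = i then 1 else 0" 0] show ?thesis
    by (simp add: coord_def unit_cube_def mcn_hoop_simps)
qed

lemma mcn_Max_closed:
  fixes g :: "'i \<Rightarrow> real ^ 'd::finite \<Rightarrow> real"
  assumes "finite A" "A \<noteq> {}" "\<And>i. i \<in> A \<Longrightarrow> g i \<in> carrier mcn_hoop"
  shows "(\<lambda>p\<in>unit_cube. Max ((\<lambda>i. g i p) ` A)) \<in> carrier mcn_hoop"
  using assms
proof (induction A rule: finite_ne_induct)
  case (singleton i)
  then show ?case by (simp add: extensional_restrict[OF mcn_extensional])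
next
  case (insert i A)
  let ?h = "\<lambda>p\<in>unit_cube. Max ((\<lambda>i. g i p) ` A)"
  have max_eq_plus_diff: "max x y = y + max 0 (x - y)" for x y :: real
    by simp
  have "?h \<in> carrier mcn_hoop"
    using insert.IH insert.prems by blast
  then have "hplus mcn_hoop ?h (hdiff mcn_hoop (g i) ?h) \<in> carrier mcn_hoop"
    using insert.prems by (intro mcn.plus_closed mcn.diff_closed) auto
  moreover have "(\<lambda>p\<in>unit_cube. Max ((\<lambda>i. g i p) ` insert i A))
      = hplus mcn_hoop ?h (hdiff mcn_hoop (g i) ?h)"
    using insert.hyps max_eq_plus_diff[of "g i p" for p]
    by (simp add: mcn_hoop_simps fun_eq_iff restrict_def)
  ultimately show ?case
    by (simp only:)
qed

lemma last_gen_carrier: "last_gen \<in> carrier (mcn_hoop :: (real ^ 'd::finite \<Rightarrow> real) hoop)"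
proof -
  let ?m = "\<lambda>p :: real ^ 'd\<in>unit_cube. Max (range (\<lambda>i. coord i p))"
  have last_gen_eq: "last_gen = hdiff mcn_hoop one_fun ?m"
    by (auto simp: last_gen_def mcn_hoop_simps fun_eq_iff unit_cube_def one_fun_def coord_def)
  show ?thesis
    unfolding last_gen_eq
    by (intro mcn.diff_closed one_fun_carrier mcn_Max_closed coord_carrier) auto
qed

lemma compact_unit_cube: "compact (unit_cube :: (real ^ 'd::finite) set)"
proof -
  have "unit_cube = cbox (0 :: real ^ 'd) 1"
    by (auto simp: unit_cube_def mem_box_cart)
  then show ?thesis by (metis compact_cbox)
qed

lemma mcn_strong_unitI:
  fixes u :: "real ^ 'd::finite \<Rightarrow> real"
  assumes u: "u \<in> carrier mcn_hoop" and nonzero: "\<And>p. p \<in> unit_cube \<Longrightarrow> u p \<noteq> 0"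
  shows "hoop_strong_unit mcn_hoop u"
  unfolding hoop_strong_unit_def hoop_le_mcn_iff
proof (intro conjI ballI u)
  fix h :: "real ^ 'd \<Rightarrow> real"
  assume h: "h \<in> carrier mcn_hoop"
  have "continuous_on unit_cube (\<lambda>p. h p / u p)"
    using nonzero by (intro continuous_on_divide mcn_continuous_on u h) auto
  then have "bounded ((\<lambda>p. h p / u p) ` unit_cube)"
    by (intro compact_imp_bounded compact_continuous_image compact_unit_cube)
  then obtain B where B: "\<And>p. p \<in> unit_cube \<Longrightarrow> \<bar>h p / u p\<bar> \<le> B"
    by (auto simp: bounded_iff)
  obtain k :: nat where "B \<le> real k"
    using real_arch_simple by blast
  have "h p \<le> hoop_multiple mcn_hoop k u p" if p: "p \<in> unit_cube" for p
  proof -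
    have "u p > 0"
      using mcn_nonneg[OF p u] nonzero[OF p] by simp
    moreover have "h p / u p \<le> real k"
      using B[OF p] \<open>B \<le> real k\<close> by linarith
    ultimately have "h p \<le> real k * u p"
      by (simp add: field_simps)
    then show ?thesis
      by (simp add: mcn.real_hom_multiple[OF evaluation_real_hom[OF p] u])
  qed
  then show "\<exists>k. \<forall>p\<in>unit_cube. h p \<le> hoop_multiple mcn_hoop k u p" by blast
qed

lemma one_fun_strong_unit: "hoop_strong_unit (mcn_hoop :: (real ^ 'd::finite \<Rightarrow> real) hoop) one_fun"
  by (intro mcn_strong_unitI one_fun_carrier) simp

lemma point_ideal_proper:
  assumes "p \<in> (unit_cube :: (real ^ 'd::finite) set)"
  shows "hoop_proper_ideal mcn_hoop (point_ideal p)"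
  using mcn.real_hom_kernel_prime[OF evaluation_real_hom[OF assms] one_fun_carrier] assms
  by (simp add: point_ideal_eq_kernel hoop_prime_ideal_def)

lemma proper_ideal_member_has_zero:
  fixes u :: "real ^ 'd::finite \<Rightarrow> real"
  assumes I: "hoop_proper_ideal mcn_hoop I" and u: "u \<in> I"
  shows "\<exists>p\<in>unit_cube. u p = 0"
proof (rule ccontr)
  assume "\<not> ?thesis"
  with u I have "hoop_strong_unit mcn_hoop u"
    by (intro mcn_strong_unitI) (auto simp: hoop_ideal_def)
  with I u have "I = carrier mcn_hoop"
    by (intro ideal_eq_carrier_if_strong_unit_mem) auto
  with I show False by simp
qed

lemma proper_ideal_subset_point_ideal:
  fixes I :: "(real ^ 'd::finite \<Rightarrow> real) set"
  assumes I: "hoop_proper_ideal mcn_hoop I"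
  shows "\<exists>q\<in>unit_cube. I \<subseteq> point_ideal q"
proof -
  have sub: "I \<subseteq> carrier mcn_hoop"
    using I by (simp add: hoop_ideal_def)
  let ?Z = "\<lambda>h. {p \<in> unit_cube. h p = 0} :: (real ^ 'd) set"
  have "unit_cube \<inter> \<Inter> (?Z ` I) \<noteq> {}"
  proof (rule compact_imp_fip_image[OF compact_unit_cube])
    fix h assume "h \<in> I"
    then have "continuous_on unit_cube h"
      using sub by (blast intro: mcn_continuous_on)
    then show "closed (?Z h)"
      using continuous_closed_preimage_constant compact_imp_closed[OF compact_unit_cube] by blast
  next
    fix F assume F: "finite F" "F \<subseteq> I"
    obtain u where u: "u \<in> I" "\<And>h p. h \<in> F \<Longrightarrow> p \<in> unit_cube \<Longrightarrow> h p \<le> u p"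
      using mcn.ideal_finite_upper_bound[OF _ F] I unfolding hoop_le_mcn_iff by blast
    obtain p where p: "p \<in> unit_cube" "u p = 0"
      using proper_ideal_member_has_zero[OF I u(1)] by blast
    have "h p = 0" if "h \<in> F" for h
      using u(2)[OF that p(1)] mcn_nonneg[OF p(1), of h] that F(2) sub p(2) by force
    with p(1) show "unit_cube \<inter> \<Inter> (?Z ` F) \<noteq> {}" by blast
  qed
  then obtain q where "q \<in> unit_cube" "\<And>h. h \<in> I \<Longrightarrow> h q = 0"
    by blast
  with sub show ?thesis
    by (auto simp: point_ideal_def)
qed

lemma point_ideal_subset_imp_eq:
  fixes p q :: "real ^ 'd::finite"
  assumes p: "p \<in> unit_cube" and q: "q \<in> unit_cube" and sub: "point_ideal p \<subseteq> point_ideal q"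
  shows "p = q"
proof -
  have "p $ i = q $ i" for i
    using mcn.real_hom_proportional[OF evaluation_real_hom[OF p] evaluation_real_hom[OF q]
        sub[unfolded point_ideal_eq_kernel] coord_carrier one_fun_carrier] p q
    by simp
  then show ?thesis by (simp add: vec_eq_iff)
qed

theorem bij_betw_point_ideal_max_spec:
  "bij_betw point_ideal (unit_cube :: (real ^ 'd::finite) set) (hoop_max_spec mcn_hoop)"
  by (intro bij_betw_hoop_max_spec point_ideal_proper proper_ideal_subset_point_ideal
      point_ideal_subset_imp_eq)

theorem mcn_real_hom_is_scaled_evaluation:
  fixes \<phi> :: "(real ^ 'd::finite \<Rightarrow> real) \<Rightarrow> real"
  assumes \<phi>: "hoop_real_hom mcn_hoop \<phi>" and nonzero: "\<phi> one_fun \<noteq> 0"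
  obtains q where "q \<in> unit_cube" "\<And>h. h \<in> carrier mcn_hoop \<Longrightarrow> \<phi> h = \<phi> one_fun * h q"
proof -
  have "hoop_proper_ideal mcn_hoop (hoop_kernel mcn_hoop \<phi>)"
    using mcn.real_hom_kernel_prime[OF \<phi> one_fun_carrier nonzero]
    by (simp add: hoop_prime_ideal_def)
  then obtain q where q: "q \<in> unit_cube" "hoop_kernel mcn_hoop \<phi> \<subseteq> point_ideal q"
    using proper_ideal_subset_point_ideal by blast
  then show thesis
    using mcn.real_hom_proportional[OF \<phi> evaluation_real_hom, of q _ one_fun] one_fun_carrier
    by (intro that[of q]) (auto simp: point_ideal_eq_kernel)
qed


section \<open>The dual map of an endomorphism\<close>

definition endo_point_map ::
    "((real ^ 'd \<Rightarrow> real) \<Rightarrow> real ^ 'd \<Rightarrow> real) \<Rightarrow> real ^ 'd \<Rightarrow> real ^ 'd" where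
  "endo_point_map \<sigma> p = (\<chi> i. \<sigma> (coord i) p / \<sigma> one_fun p)"

context
  fixes \<sigma> :: "(real ^ 'd::finite \<Rightarrow> real) \<Rightarrow> real ^ 'd \<Rightarrow> real"
  assumes \<sigma>: "hoop_nontrivial_endo mcn_hoop \<sigma>"
begin

lemma nontrivial_endo_one_fun_pos:
  assumes p: "p \<in> unit_cube"
  shows "0 < \<sigma> one_fun p"
proof -
  have "\<sigma> one_fun p \<noteq> 0"
    using mcn.nontrivial_endo_strong_unit_neq_0[OF \<sigma> one_fun_strong_unit evaluation_real_hom[OF p]
        one_fun_carrier] p by simp
  moreover have "\<sigma> one_fun \<in> carrier mcn_hoop"
    by (rule endo_closed[OF nontrivial_endo_imp_endo[OF \<sigma>] one_fun_carrier])
  ultimately show ?thesis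
    using mcn_nonneg[OF p, of "\<sigma> one_fun"] by simp
qed

lemma
  assumes p: "p \<in> unit_cube"
  shows endo_point_map_in_cube: "endo_point_map \<sigma> p \<in> unit_cube"
    and nontrivial_endo_apply:
      "h \<in> carrier mcn_hoop \<Longrightarrow> \<sigma> h p = \<sigma> one_fun p * h (endo_point_map \<sigma> p)"
proof -
  have hom: "hoop_real_hom mcn_hoop (\<lambda>h. \<sigma> h p)"
    by (rule real_hom_comp_endo[OF evaluation_real_hom[OF p] nontrivial_endo_imp_endo[OF \<sigma>]])
  have "\<sigma> one_fun p \<noteq> 0"
    using nontrivial_endo_one_fun_pos[OF p] by simp
  with hom obtain q where q: "q \<in> unit_cube"
    and eval: "\<And>h. h \<in> carrier mcn_hoop \<Longrightarrow> \<sigma> h p = \<sigma> one_fun p * h q"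
    by (rule mcn_real_hom_is_scaled_evaluation) blast
  have "endo_point_map \<sigma> p = q"
    using nontrivial_endo_one_fun_pos[OF p] q
    by (simp add: endo_point_map_def vec_eq_iff eval[OF coord_carrier])
  with q eval show "endo_point_map \<sigma> p \<in> unit_cube"
    and "h \<in> carrier mcn_hoop \<Longrightarrow> \<sigma> h p = \<sigma> one_fun p * h (endo_point_map \<sigma> p)" by auto
qed

lemma nontrivial_endo_coord_bounds:
  assumes p: "p \<in> unit_cube"
  shows "0 \<le> \<sigma> (coord i) p" "\<sigma> (coord i) p \<le> \<sigma> one_fun p"
proof -
  have "0 \<le> endo_point_map \<sigma> p $ i" "endo_point_map \<sigma> p $ i \<le> 1"
    using endo_point_map_in_cube[OF p] by (simp_all add: unit_cube_def)
  then show "0 \<le> \<sigma> (coord i) p" "\<sigma> (coord i) p \<le> \<sigma> one_fun p"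
    using nontrivial_endo_one_fun_pos[OF p] endo_point_map_in_cube[OF p]
    by (simp_all add: nontrivial_endo_apply[OF p coord_carrier] mult_left_le)
qed

lemma nontrivial_endo_one_fun_eq_last_gen_plus_Max:
  assumes p: "p \<in> unit_cube"
  shows "\<sigma> one_fun p = \<sigma> last_gen p + Max (range (\<lambda>i. \<sigma> (coord i) p))"
proof -
  let ?c = "\<sigma> one_fun p" and ?q = "endo_point_map \<sigma> p"
  have "mono (\<lambda>x. ?c * x)"
    using nontrivial_endo_one_fun_pos[OF p] by (intro monoI mult_left_mono) auto
  from mono_Max_commute[OF this, of "range (\<lambda>i. ?q $ i)"]
  have "Max (range (\<lambda>i. \<sigma> (coord i) p)) = ?c * Max (range (\<lambda>i. ?q $ i))"
    by (simp add: nontrivial_endo_apply[OF p coord_carrier] endo_point_map_in_cube[OF p]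
        image_image)
  moreover have "\<sigma> last_gen p = ?c * (1 - Max (range (\<lambda>i. ?q $ i)))"
    using endo_point_map_in_cube[OF p]
    by (simp add: nontrivial_endo_apply[OF p last_gen_carrier])
  ultimately show ?thesis
    by (simp add: algebra_simps)
qed

theorem hoop_dual_point_ideal:
  assumes p: "p \<in> unit_cube"
  shows "hoop_dual mcn_hoop \<sigma> (point_ideal p) = point_ideal (endo_point_map \<sigma> p)"
proof -
  have "hoop_dual mcn_hoop \<sigma> (point_ideal p) = hoop_kernel mcn_hoop (\<lambda>h. \<sigma> h p)"
    by (simp add: point_ideal_eq_kernel hoop_dual_kernel nontrivial_endo_imp_endo[OF \<sigma>])
  also have "\<dots> = point_ideal (endo_point_map \<sigma> p)"
    using nontrivial_endo_one_fun_pos[OF p]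
    by (auto simp: hoop_kernel_def point_ideal_def nontrivial_endo_apply[OF p])
  finally show ?thesis .
qed

end

theorem theorem3p3:
  fixes \<sigma> :: "(real ^ 'd::finite \<Rightarrow> real) \<Rightarrow> (real ^ 'd \<Rightarrow> real)"
    and f :: "'d \<Rightarrow> real ^ 'd \<Rightarrow> real"
    and fn fsharp :: "real ^ 'd \<Rightarrow> real"
    and S :: "real ^ 'd \<Rightarrow> real ^ 'd"
  assumes sigma: "hoop_nontrivial_endo mcn_hoop \<sigma>"
    and f: "\<And>i. f i = \<sigma> (coord i)"
    and fn: "fn = \<sigma> last_gen"
    and fsharp: "fsharp = (\<lambda>p\<in>unit_cube. fn p + Max (range (\<lambda>i. f i p)))"
    and S: "\<And>p. S p = (\<chi> i. f i p / fsharp p)"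
  shows "fsharp = \<sigma> one_fun \<and>
         hoop_strong_unit mcn_hoop fsharp \<and>
         (\<forall>p\<in>unit_cube. fsharp p \<noteq> 0) \<and>
         (\<forall>p\<in>unit_cube. \<forall>i. 0 \<le> f i p \<and> f i p \<le> fsharp p) \<and>
         S \<in> unit_cube \<rightarrow> unit_cube \<and>
         bij_betw point_ideal (unit_cube :: (real ^ 'd) set) (hoop_max_spec mcn_hoop) \<and>
         (\<forall>p\<in>unit_cube. hoop_dual mcn_hoop \<sigma> (point_ideal p) = point_ideal (S p))"
proof -
  have one_image_carrier: "\<sigma> one_fun \<in> carrier mcn_hoop"
    by (rule endo_closed[OF nontrivial_endo_imp_endo[OF sigma] one_fun_carrier])
  have sharp: "fsharp = \<sigma> one_fun"
  proof (rule extensionalityI[OF _ mcn_extensional[OF one_image_carrier]])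
    show "fsharp \<in> extensional unit_cube"
      by (simp add: fsharp)
  qed (simp add: fsharp fn f nontrivial_endo_one_fun_eq_last_gen_plus_Max[OF sigma])
  have S_eq: "S = endo_point_map \<sigma>"
    by (simp add: fun_eq_iff S f sharp endo_point_map_def)
  have nonzero: "\<forall>p\<in>unit_cube. fsharp p \<noteq> 0"
    unfolding sharp using nontrivial_endo_one_fun_pos[OF sigma] by fastforce
  then have "hoop_strong_unit mcn_hoop fsharp"
    using one_image_carrier by (intro mcn_strong_unitI) (auto simp: sharp)
  moreover have "\<forall>p\<in>unit_cube. \<forall>i. 0 \<le> f i p \<and> f i p \<le> fsharp p"
    using nontrivial_endo_coord_bounds[OF sigma] by (simp add: f sharp)
  moreover have "S \<in> unit_cube \<rightarrow> unit_cube"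
    using endo_point_map_in_cube[OF sigma] by (auto simp: S_eq)
  ultimately show ?thesis
    using sharp nonzero bij_betw_point_ideal_max_spec hoop_dual_point_ideal[OF sigma]
    by (simp add: S_eq)
qed

end
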